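(* Let $\alpha,\beta\in(0,1)$. (i) Let $\alpha/2<\gamma'<\gamma<1$ and $\delta\in(\beta/3,1)$, and let $\hat\chi=(\hat\tau,\hat d)$ be the first 4-stage test with parameters $n_0=n^*(\gamma,\beta/3)$, $\kappa_0=\kappa^*(\gamma,\beta/3)$, $n_1=n^*(\alpha/2,\delta)$, $\kappa_1=\kappa^*(\alpha/2,\delta)$, $N_0=n^*(\gamma',\beta/3)$, $K_0=\kappa^*(\gamma',\beta/3)$, $N=n^*(\alpha/2,\beta/3)$, $K=\kappa^*(\alpha/2,\beta/3)$. Then $\hat\chi\in\mathcal C(\alpha,\beta)$. (ii) Let $\gamma\in(\alpha/3,1)$ and $\beta/2<\delta'<\delta<1$, and let $\check\chi=(\check\tau,\check d)$ be the second 4-stage test with parameters $n_0=n^*(\gamma,\beta/2)$, $\kappa_0=\kappa^*(\gamma,\beta/2)$, $n_1=n^*(\alpha/3,\delta)$, $\kappa_1=\kappa^*(\alpha/3,\delta)$, $N_1=n^*(\alpha/3,\delta')$, $K_1=\kappa^*(\alpha/3,\delta')$, $N=n^*(\alpha/3,\beta/2)$, $K=\kappa^*(\alpha/3,\beta/2)$. Then $\check\chi\in\mathcal C(\alpha,\beta)$.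
   Context: Setting. Let $X=(X_n)_{n\ge1}$ be a sequence of random elements of a measurable space $(\mathbb S,\mathcal S)$ and $\mathcal F_n=\sigma(X_1,\dots,X_n)$. The distribution of $X$ belongs to a family $\mathcal P$; $\mathcal P_0,\mathcal P_1\subset\mathcal P$ are disjoint, $H_i$ is the hypothesis that this distribution is in $\mathcal P_i$, and $\mathsf P_0\in\mathcal P_0$, $\mathsf P_1\in\mathcal P_1$ are fixed. A test is a pair $(\tau,d)$ where $\tau$ is a stopping time of $(\mathcal F_n)_{n\ge1}$ and $d\in\{0,1\}$ is $\mathcal F_\tau$-measurable ($d=i$ means that $H_i$ is selected). For $\alpha,\beta\in(0,1)$, $\mathcal C(\alpha,\beta)$ is the set of tests with $\mathsf P_0(d=1)\le\alpha$ and $\mathsf P_1(d=0)\le\beta$. Test statistic. $T=(T_n)_{n\ge1}$ is a sequence of real-valued statistics, $T_n$ being $\mathcal F_n$-measurable, such that for all $\alpha,\beta\in(0,1)$ there are $n\in\mathbb N$ and $\kappa\in\mathbb R$ with $\mathsf P_0(T_n>\kappa)\le\alpha$ and $\mathsf P_1(T_n\le\kappa)\le\beta$. The smallest such $n$ is denoted $n^*(\alpha,\beta)$, and $\kappa^*(\alpha,\beta)$ denotes any $\kappa$ satisfying these two inequalities with $n=n^*(\alpha,\beta)$. 4-stage tests. Both have parameters: positive integers $n_0,n_1,N$ with $n_0\vee n_1<N$ and reals $\kappa_0\le\kappa_1$ and $K$. The first, $\hat\chi$, has in addition an integer $N_0$ with $n_0<N_0<N$ and a real $K_0\le\kappa_1$;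 the second, $\check\chi$, has in addition an integer $N_1$ with $n_1<N_1<N$ and a real $K_1\ge\kappa_0$. The times $n_0,n_1,N_0,N$ (for $\hat\chi$), respectively $n_0,n_1,N_1,N$ (for $\check\chi$), are visited in increasing order until a decision is made: at time $n_0$, stop and accept $H_0$ (decision $0$) if $T_{n_0}\le\kappa_0$; at time $n_1$, stop and reject $H_0$ (decision $1$) if $T_{n_1}>\kappa_1$; for $\hat\chi$, at time $N_0$, stop and accept $H_0$ if $T_{N_0}\le K_0$; for $\check\chi$, at time $N_1$, stop and reject $H_0$ if $T_{N_1}>K_1$; if no decision has been made before, stop at time $N$ and reject $H_0$ if and only if $T_N>K$. (If two of these times coincide, both checks are made at that time.) $\hat\tau,\check\tau$ are the numbers of observations used and $\hat d,\check d$ the decisions. *)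

theory Defs
  imports "HOL-Probability.Probability"
begin

text \<open>
  Observations are \<open>X 1, X 2, \<dots>\<close>; the value \<open>X 0\<close> is never used.  Times are natural
  numbers, and the index \<open>0\<close> of the filtration carries the trivial sigma-algebra.
\<close>

definition obs_filtration ::
    "'w measure \<Rightarrow> 's measure \<Rightarrow> (nat \<Rightarrow> 'w \<Rightarrow> 's) \<Rightarrow> nat \<Rightarrow> 'w measure" where
  "obs_filtration M S X n =
     sigma (space M) {X i -` A \<inter> space M | i A. i \<in> {1..n} \<and> A \<in> sets S}"

definition law_of ::
    "'s measure \<Rightarrow> (nat \<Rightarrow> 'w \<Rightarrow> 's) \<Rightarrow> 'w measure \<Rightarrow> (nat \<Rightarrow> 's) measure" where
  "law_of S X P = distr P (PiM {1..} (\<lambda>_. S)) (\<lambda>\<omega>. \<lambda>n\<in>{1..}. X n \<omega>)"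

text \<open>
  The stopping time is finite, since the decision is a function on the whole sample space.
  A stopping time of the filtration indexed by \<open>n \<ge> 1\<close> takes values \<open>\<ge> 1\<close>.
\<close>

definition is_test ::
    "'w measure \<Rightarrow> 's measure \<Rightarrow> (nat \<Rightarrow> 'w \<Rightarrow> 's) \<Rightarrow> ('w \<Rightarrow> nat) \<times> ('w \<Rightarrow> nat) \<Rightarrow> bool" where
  "is_test M S X = (\<lambda>(\<tau>, d).
     stopping_time (obs_filtration M S X) \<tau> \<and>
     (\<forall>\<omega>\<in>space M. 1 \<le> \<tau> \<omega>) \<and>
     d \<in> filtration.pre_sigma (space M) (obs_filtration M S X) \<tau> \<rightarrow>\<^sub>M count_space {0, 1})"

definition tests_with_errors ::
    "'w measure \<Rightarrow> 's measure \<Rightarrow> (nat \<Rightarrow> 'w \<Rightarrow> 's) \<Rightarrow> 'w measure \<Rightarrow> 'w measure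
      \<Rightarrow> real \<Rightarrow> real \<Rightarrow> (('w \<Rightarrow> nat) \<times> ('w \<Rightarrow> nat)) set" where
  "tests_with_errors M S X P0 P1 \<alpha> \<beta> =
     {(\<tau>, d). is_test M S X (\<tau>, d) \<and>
        measure P0 {\<omega> \<in> space P0. d \<omega> = 1} \<le> \<alpha> \<and>
        measure P1 {\<omega> \<in> space P1. d \<omega> = 0} \<le> \<beta>}"

definition fixed_sample_ok ::
    "'w measure \<Rightarrow> 'w measure \<Rightarrow> (nat \<Rightarrow> 'w \<Rightarrow> real) \<Rightarrow> real \<Rightarrow> real \<Rightarrow> nat \<Rightarrow> real \<Rightarrow> bool" where
  "fixed_sample_ok P0 P1 T \<alpha> \<beta> n \<kappa> \<longleftrightarrow>
     measure P0 {\<omega> \<in> space P0. T n \<omega> > \<kappa>} \<le> \<alpha> \<and>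
     measure P1 {\<omega> \<in> space P1. T n \<omega> \<le> \<kappa>} \<le> \<beta>"

definition n_star ::
    "'w measure \<Rightarrow> 'w measure \<Rightarrow> (nat \<Rightarrow> 'w \<Rightarrow> real) \<Rightarrow> real \<Rightarrow> real \<Rightarrow> nat" where
  "n_star P0 P1 T \<alpha> \<beta> = (LEAST n. 1 \<le> n \<and> (\<exists>\<kappa>. fixed_sample_ok P0 P1 T \<alpha> \<beta> n \<kappa>))"

text \<open>
  \<open>M\<close> is used only as a measurable space, on which \<open>P0\<close> and \<open>P1\<close> are probability measures;
  \<open>Laws\<close>, \<open>Laws0\<close>, \<open>Laws1\<close> are families of distributions of the whole sequence
  \<open>X 1, X 2, \<dots>\<close>.  The threshold \<open>\<kappa>_star \<alpha> \<beta>\<close> is an arbitrary admissible choice.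
\<close>

locale testing_problem =
  fixes M :: "'w measure" and S :: "'s measure" and X :: "nat \<Rightarrow> 'w \<Rightarrow> 's"
    and Laws Laws0 Laws1 :: "(nat \<Rightarrow> 's) measure set"
    and P0 P1 :: "'w measure"
    and T :: "nat \<Rightarrow> 'w \<Rightarrow> real"
    and \<kappa>_star :: "real \<Rightarrow> real \<Rightarrow> real"
  assumes X_measurable: "\<And>n. 1 \<le> n \<Longrightarrow> X n \<in> M \<rightarrow>\<^sub>M S"
    and Laws: "\<And>Q. Q \<in> Laws \<Longrightarrow> prob_space Q \<and> sets Q = sets (PiM {1..} (\<lambda>_. S))"
    and hypotheses: "Laws0 \<subseteq> Laws" "Laws1 \<subseteq> Laws" "Laws0 \<inter> Laws1 = {}"
    and P0: "prob_space P0" "sets P0 = sets M" "law_of S X P0 \<in> Laws0"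
    and P1: "prob_space P1" "sets P1 = sets M" "law_of S X P1 \<in> Laws1"
    and T_adapted: "\<And>n. 1 \<le> n \<Longrightarrow> T n \<in> borel_measurable (obs_filtration M S X n)"
    and T_ok: "\<And>\<alpha> \<beta>. 0 < \<alpha> \<Longrightarrow> \<alpha> < 1 \<Longrightarrow> 0 < \<beta> \<Longrightarrow> \<beta> < 1 \<Longrightarrow>
                 \<exists>n\<ge>1. \<exists>\<kappa>. fixed_sample_ok P0 P1 T \<alpha> \<beta> n \<kappa>"
    and \<kappa>_star: "\<And>\<alpha> \<beta>. 0 < \<alpha> \<Longrightarrow> \<alpha> < 1 \<Longrightarrow> 0 < \<beta> \<Longrightarrow> \<beta> < 1 \<Longrightarrow>
                 fixed_sample_ok P0 P1 T \<alpha> \<beta> (n_star P0 P1 T \<alpha> \<beta>) (\<kappa>_star \<alpha> \<beta>)"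

text \<open>
  \<open>acc n \<omega>\<close> (\<open>rej n \<omega>\<close>) says that some check carried out at time \<open>n\<close> leads to accepting
  (rejecting) the null hypothesis.  The test stops at the first time at which a check succeeds.
  For admissible parameters of the 4-stage tests below such a time exists, at most \<open>N\<close>, and
  \<open>acc n \<omega>\<close> and \<open>rej n \<omega>\<close> exclude each other, even if two of the times coincide.
\<close>

definition stop_at_first_decision ::
    "(nat \<Rightarrow> 'w \<Rightarrow> bool) \<Rightarrow> (nat \<Rightarrow> 'w \<Rightarrow> bool) \<Rightarrow> ('w \<Rightarrow> nat) \<times> ('w \<Rightarrow> nat)" where
  "stop_at_first_decision acc rej =
     (let \<tau> = (\<lambda>\<omega>. LEAST n. acc n \<omega> \<or> rej n \<omega>)
      in (\<tau>, \<lambda>\<omega>. if rej (\<tau> \<omega>) \<omega> then 1 else 0))"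

definition first_params ::
    "nat \<Rightarrow> nat \<Rightarrow> nat \<Rightarrow> nat \<Rightarrow> real \<Rightarrow> real \<Rightarrow> real \<Rightarrow> bool" where
  "first_params n0 n1 N0 N \<kappa>0 \<kappa>1 K0 \<longleftrightarrow>
     0 < n0 \<and> 0 < n1 \<and> max n0 n1 < N \<and> \<kappa>0 \<le> \<kappa>1 \<and>
     n0 < N0 \<and> N0 < N \<and> K0 \<le> \<kappa>1"

definition first_test ::
    "(nat \<Rightarrow> 'w \<Rightarrow> real) \<Rightarrow> nat \<Rightarrow> nat \<Rightarrow> nat \<Rightarrow> nat \<Rightarrow> real \<Rightarrow> real \<Rightarrow> real \<Rightarrow> real
      \<Rightarrow> ('w \<Rightarrow> nat) \<times> ('w \<Rightarrow> nat)" where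
  "first_test T n0 n1 N0 N \<kappa>0 \<kappa>1 K0 K = stop_at_first_decision
     (\<lambda>n \<omega>. n = n0 \<and> T n \<omega> \<le> \<kappa>0 \<or> n = N0 \<and> T n \<omega> \<le> K0 \<or> n = N \<and> T n \<omega> \<le> K)
     (\<lambda>n \<omega>. n = n1 \<and> T n \<omega> > \<kappa>1 \<or> n = N \<and> T n \<omega> > K)"

definition second_params ::
    "nat \<Rightarrow> nat \<Rightarrow> nat \<Rightarrow> nat \<Rightarrow> real \<Rightarrow> real \<Rightarrow> real \<Rightarrow> bool" where
  "second_params n0 n1 N1 N \<kappa>0 \<kappa>1 K1 \<longleftrightarrow>
     0 < n0 \<and> 0 < n1 \<and> max n0 n1 < N \<and> \<kappa>0 \<le> \<kappa>1 \<and>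
     n1 < N1 \<and> N1 < N \<and> \<kappa>0 \<le> K1"

definition second_test ::
    "(nat \<Rightarrow> 'w \<Rightarrow> real) \<Rightarrow> nat \<Rightarrow> nat \<Rightarrow> nat \<Rightarrow> nat \<Rightarrow> real \<Rightarrow> real \<Rightarrow> real \<Rightarrow> real
      \<Rightarrow> ('w \<Rightarrow> nat) \<times> ('w \<Rightarrow> nat)" where
  "second_test T n0 n1 N1 N \<kappa>0 \<kappa>1 K1 K = stop_at_first_decision
     (\<lambda>n \<omega>. n = n0 \<and> T n \<omega> \<le> \<kappa>0 \<or> n = N \<and> T n \<omega> \<le> K)
     (\<lambda>n \<omega>. n = n1 \<and> T n \<omega> > \<kappa>1 \<or> n = N1 \<and> T n \<omega> > K1 \<or> n = N \<and> T n \<omega> > K)"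

end

theory Submission
  imports Defs
begin

text \<open>
  A wrong decision is made only if some check that leads to it succeeds.  The first 4-stage
  test rejects only after a success of one of its two rejection checks, at the times \<open>n1\<close> and \<open>N\<close>,
  and each of these succeeds with \<open>P0\<close>-probability at most \<open>\<alpha> / 2\<close>, because its time and
  threshold come from a fixed-sample-size test whose type-I level is \<open>\<alpha> / 2\<close>.  It accepts only
  after a success of one of its three acceptance checks, at \<open>n0\<close>, \<open>N0\<close> and \<open>N\<close>, each of
  \<open>P1\<close>-probability at most \<open>\<beta> / 3\<close>.  A union bound over the checks that allow a given
  decision gives the error bounds, whatever the dependence between the checks.  The second test is
  the same with the roles of the hypotheses exchanged.

  Both tests are therefore instances of one scheme: finitely many acceptance checks \<open>T n \<le> k\<close> and
  rejection checks \<open>T n > k\<close>, with one pair \<open>(N, K)\<close> among both, so that at \<open>N\<close> one of the two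
  must succeed.  The error bounds of this scheme are \<open>threshold_test_errors\<close>.  That it is a test at
  all is \<open>is_test_stop_at_first_decision\<close>: whether a decision has been made by time \<open>t\<close>, and
  which one, depends only on the checks made up to time \<open>t\<close>.
\<close>

context testing_problem
begin

lemma space_obs_filtration: "space (obs_filtration M S X n) = space M"
  unfolding obs_filtration_def by (rule space_measure_of) auto

lemma sets_obs_filtration:
  "sets (obs_filtration M S X n) =
     sigma_sets (space M) {X i -` A \<inter> space M | i A. i \<in> {1..n} \<and> A \<in> sets S}"
  unfolding obs_filtration_def by (rule sets_measure_of) auto

lemma sets_obs_filtration_subset: "sets (obs_filtration M S X n) \<subseteq> sets M"
  unfolding sets_obs_filtration
  by (rule sets.sigma_sets_subset) (auto intro: measurable_sets[OF X_measurable])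

lemma filtration_obs_filtration: "filtration (space M) (obs_filtration M S X)"
proof
  show "sets (obs_filtration M S X i) \<subseteq> sets (obs_filtration M S X j)" if "i \<le> j" for i j
    unfolding sets_obs_filtration using that by (intro sigma_sets_mono') fastforce
qed (rule space_obs_filtration)

text \<open>
  The last hypothesis is what makes \<open>\<tau> \<omega> \<le> t\<close> an event of time \<open>t\<close>: the least time in the
  definition of the test is attained, so the test has stopped by \<open>t\<close> if and only if one of the
  finitely many checks up to \<open>t\<close> succeeds.
\<close>

lemma is_test_stop_at_first_decision:
  assumes acc: "\<And>n. Measurable.pred (obs_filtration M S X n) (acc n)"
    and rej: "\<And>n. Measurable.pred (obs_filtration M S X n) (rej n)"
    and undecided: "\<And>\<omega>. \<omega> \<in> space M \<Longrightarrow> \<not> acc 0 \<omega> \<and> \<not> rej 0 \<omega>"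
    and decided: "\<And>\<omega>. \<omega> \<in> space M \<Longrightarrow> \<exists>n. acc n \<omega> \<or> rej n \<omega>"
  shows "is_test M S X (stop_at_first_decision acc rej)"
proof -
  interpret filtration "space M" "obs_filtration M S X"
    by (rule filtration_obs_filtration)
  define \<tau> where "\<tau> = (\<lambda>\<omega>. LEAST n. acc n \<omega> \<or> rej n \<omega>)"
  define d :: "'w \<Rightarrow> nat" where "d = (\<lambda>\<omega>. if rej (\<tau> \<omega>) \<omega> then 1 else 0)"
  have at_\<tau>: "acc (\<tau> \<omega>) \<omega> \<or> rej (\<tau> \<omega>) \<omega>" if "\<omega> \<in> space M" for \<omega>
    unfolding \<tau>_def using decided[OF that] by (rule LeastI_ex)
  have \<tau>_le: "\<tau> \<omega> \<le> t \<longleftrightarrow> (\<exists>n\<in>{..t}. acc n \<omega> \<or> rej n \<omega>)" if "\<omega> \<in> space M" for \<omega> t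
    using at_\<tau>[OF that] unfolding \<tau>_def by (auto intro: Least_le order_trans)
  have later: "Measurable.pred (obs_filtration M S X t) (\<lambda>\<omega>. Q n \<omega>)"
    if "n \<le> t" "\<And>n. Measurable.pred (obs_filtration M S X n) (Q n)" for n t Q
    using that(2)[of n] measurable_mono[OF order_refl _ sets_F_mono[OF that(1)]]
    by (auto simp: space_obs_filtration)
  have st: "stopping_time (obs_filtration M S X) \<tau>"
  proof (rule stopping_timeI)
    fix t
    have "Measurable.pred (obs_filtration M S X t) (\<lambda>\<omega>. \<exists>n\<in>{..t}. acc n \<omega> \<or> rej n \<omega>)"
      using later[OF _ acc] later[OF _ rej] by (intro pred_intros_finite pred_intros_logic) auto
    then show "Measurable.pred (obs_filtration M S X t) (\<lambda>\<omega>. \<tau> \<omega> \<le> t)"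
      by (subst measurable_cong[where g="\<lambda>\<omega>. \<exists>n\<in>{..t}. acc n \<omega> \<or> rej n \<omega>"])
        (auto simp: \<tau>_le space_obs_filtration)
  qed
  have "Measurable.pred (pre_sigma \<tau>) (\<lambda>\<omega>. rej (\<tau> \<omega>) \<omega>)"
  proof (rule pred_pre_sigmaI[OF st])
    fix t
    have "Measurable.pred (obs_filtration M S X t) (\<lambda>\<omega>. \<exists>n\<in>{..t}. \<tau> \<omega> = n \<and> rej n \<omega>)"
      using later[OF _ rej] later[OF _ stopping_time_eq_const[OF st]]
      by (intro pred_intros_finite pred_intros_logic) auto
    moreover have "(\<lambda>\<omega>. \<exists>n\<in>{..t}. \<tau> \<omega> = n \<and> rej n \<omega>) = (\<lambda>\<omega>. rej (\<tau> \<omega>) \<omega> \<and> \<tau> \<omega> \<le> t)"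
      by auto
    ultimately show "Measurable.pred (obs_filtration M S X t) (\<lambda>\<omega>. rej (\<tau> \<omega>) \<omega> \<and> \<tau> \<omega> \<le> t)"
      by simp
  qed
  then have "d \<in> pre_sigma \<tau> \<rightarrow>\<^sub>M count_space {0, 1}"
    unfolding d_def by (intro measurable_If) (auto simp: pred_def)
  moreover have "1 \<le> \<tau> \<omega>" if "\<omega> \<in> space M" for \<omega>
    using at_\<tau>[OF that] undecided[OF that] by (cases "\<tau> \<omega>") auto
  moreover have "stop_at_first_decision acc rej = (\<tau>, d)"
    by (simp add: stop_at_first_decision_def Let_def \<tau>_def d_def)
  ultimately show ?thesis
    using st by (simp add: is_test_def)
qed

lemma T_measurable: "T n \<in> borel_measurable M" if "1 \<le> n"
  using T_adapted[OF that] measurable_mono[OF order_refl refl sets_obs_filtration_subset]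
  by (auto simp: space_obs_filtration)

lemma pred_check_at_time:
  assumes "finite C" and "\<And>n k. (n, k) \<in> C \<Longrightarrow> 1 \<le> n"
    and "\<And>k. Measurable.pred borel (Q k)"
  shows "Measurable.pred (obs_filtration M S X n) (\<lambda>\<omega>. \<exists>k. (n, k) \<in> C \<and> Q k (T n \<omega>))"
proof (cases "\<exists>k. (n, k) \<in> C")
  case True
  then have n: "1 \<le> n"
    using assms(2) by blast
  have "Measurable.pred (obs_filtration M S X n) (\<lambda>\<omega>. \<exists>x\<in>C. fst x = n \<and> Q (snd x) (T n \<omega>))"
    using assms(1) measurable_compose[OF T_adapted[OF n] assms(3)]
    by (intro pred_intros_finite pred_intros_logic) auto
  moreover have "(\<lambda>\<omega>. \<exists>x\<in>C. fst x = n \<and> Q (snd x) (T n \<omega>)) =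
      (\<lambda>\<omega>. \<exists>k. (n, k) \<in> C \<and> Q k (T n \<omega>))"
    by force
  ultimately show ?thesis
    by simp
qed simp

lemma measure_some_check_le:
  fixes c :: real
  assumes P: "sets P = sets M"
    and C: "finite C" "\<And>n k. (n, k) \<in> C \<Longrightarrow> 1 \<le> n"
    and Q: "\<And>k. Measurable.pred borel (Q k)"
    and level: "\<And>n k. (n, k) \<in> C \<Longrightarrow> measure P {\<omega> \<in> space P. Q k (T n \<omega>)} \<le> c"
  shows "measure P {\<omega> \<in> space P. \<exists>(n, k)\<in>C. Q k (T n \<omega>)} \<le> card C * c"
    and "{\<omega> \<in> space P. \<exists>(n, k)\<in>C. Q k (T n \<omega>)} \<in> sets P"
proof -
  define E where "E = (\<lambda>(n, k). {\<omega> \<in> space P. Q k (T n \<omega>)})"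
  have meas: "E x \<in> sets P" if x: "x \<in> C" for x
  proof (cases x)
    case (Pair n k)
    then have "T n \<in> borel_measurable P"
      using T_measurable[of n] C(2) x by (simp add: measurable_cong_sets[OF P refl])
    from measurable_compose[OF this Q[of k]] show ?thesis
      by (simp add: pred_def E_def Pair)
  qed
  have union: "(\<Union>x\<in>C. E x) = {\<omega> \<in> space P. \<exists>(n, k)\<in>C. Q k (T n \<omega>)}"
    by (auto simp: E_def)
  have "measure P (\<Union>x\<in>C. E x) \<le> (\<Sum>x\<in>C. measure P (E x))"
    using C(1) meas by (intro measure_UNION_le)
  also have "\<dots> \<le> card C * c"
    using level by (intro sum_bounded_above) (auto simp: E_def)
  finally show "measure P {\<omega> \<in> space P. \<exists>(n, k)\<in>C. Q k (T n \<omega>)} \<le> card C * c"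
    by (simp only: union)
  show "{\<omega> \<in> space P. \<exists>(n, k)\<in>C. Q k (T n \<omega>)} \<in> sets P"
    unfolding union[symmetric] using C(1) meas by (intro sets.finite_UN)
qed

text \<open>
  The checks are sets of pairs of a time and a threshold, so that checks made at the same time need
  no separate treatment.  The errors are bounded by the number of checks that allow them, each
  counted with its own level: a wrong decision is never made without a success of such a check.
\<close>

lemma threshold_test_errors:
  fixes a b \<alpha> \<beta> :: real
  assumes fin: "finite A" "finite R"
    and pos: "\<And>n k. (n, k) \<in> A \<union> R \<Longrightarrow> 1 \<le> n"
    and final: "(N, K) \<in> A \<inter> R"
    and type_I: "\<And>n k. (n, k) \<in> R \<Longrightarrow> measure P0 {\<omega> \<in> space P0. T n \<omega> > k} \<le> a"
    and type_II: "\<And>n k. (n, k) \<in> A \<Longrightarrow> measure P1 {\<omega> \<in> space P1. T n \<omega> \<le> k} \<le> b"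
    and budget: "card R * a \<le> \<alpha>" "card A * b \<le> \<beta>"
  shows "stop_at_first_decision (\<lambda>n \<omega>. \<exists>k. (n, k) \<in> A \<and> T n \<omega> \<le> k)
           (\<lambda>n \<omega>. \<exists>k. (n, k) \<in> R \<and> T n \<omega> > k) \<in> tests_with_errors M S X P0 P1 \<alpha> \<beta>"
proof -
  interpret P0: prob_space P0 by (rule P0)
  interpret P1: prob_space P1 by (rule P1)
  have posA: "1 \<le> n" if "(n, k) \<in> A" for n k
    using pos that by blast
  have posR: "1 \<le> n" if "(n, k) \<in> R" for n k
    using pos that by blast
  let ?acc = "\<lambda>n \<omega>. \<exists>k. (n, k) \<in> A \<and> T n \<omega> \<le> k"
  let ?rej = "\<lambda>n \<omega>. \<exists>k. (n, k) \<in> R \<and> T n \<omega> > k"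
  define \<tau> where "\<tau> = (\<lambda>\<omega>. LEAST n. ?acc n \<omega> \<or> ?rej n \<omega>)"
  define d :: "'w \<Rightarrow> nat" where "d = (\<lambda>\<omega>. if ?rej (\<tau> \<omega>) \<omega> then 1 else 0)"
  have test_eq: "stop_at_first_decision ?acc ?rej = (\<tau>, d)"
    by (simp add: stop_at_first_decision_def Let_def \<tau>_def d_def)
  have decided: "\<exists>n. ?acc n \<omega> \<or> ?rej n \<omega>" for \<omega>
    using final by (intro exI[of _ N]) (auto simp: not_le[symmetric])
  have at_\<tau>: "?acc (\<tau> \<omega>) \<omega> \<or> ?rej (\<tau> \<omega>) \<omega>" for \<omega>
    unfolding \<tau>_def using decided by (rule LeastI_ex)
  have is_test: "is_test M S X (\<tau>, d)"
    unfolding test_eq[symmetric]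
  proof (rule is_test_stop_at_first_decision)
    show "Measurable.pred (obs_filtration M S X n) (?acc n)" for n
      using fin posA by (intro pred_check_at_time[where Q = "\<lambda>k x. x \<le> k"]) auto
    show "Measurable.pred (obs_filtration M S X n) (?rej n)" for n
      using fin posR by (intro pred_check_at_time[where Q = "\<lambda>k x. x > k"]) auto
    show "\<not> ?acc 0 \<omega> \<and> \<not> ?rej 0 \<omega>" for \<omega>
      using pos[of 0] by auto
    show "\<exists>n. ?acc n \<omega> \<or> ?rej n \<omega>" for \<omega>
      by (rule decided)
  qed
  let ?E0 = "{\<omega> \<in> space P0. \<exists>(n, k)\<in>R. T n \<omega> > k}"
  have E0_meas: "?E0 \<in> sets P0" and E0: "measure P0 ?E0 \<le> card R * a"
    by (rule measure_some_check_le[where Q = "\<lambda>k x. x > k", OF P0(2) fin(2) posR _ type_I]; simp)+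
  have "{\<omega> \<in> space P0. d \<omega> = 1} \<subseteq> ?E0"
    by (auto simp: d_def split: if_splits)
  then have I: "measure P0 {\<omega> \<in> space P0. d \<omega> = 1} \<le> \<alpha>"
    using P0.finite_measure_mono[OF _ E0_meas] E0 budget(1) by (meson order_trans)
  let ?E1 = "{\<omega> \<in> space P1. \<exists>(n, k)\<in>A. T n \<omega> \<le> k}"
  have E1_meas: "?E1 \<in> sets P1" and E1: "measure P1 ?E1 \<le> card A * b"
    by (rule measure_some_check_le[where Q = "\<lambda>k x. x \<le> k", OF P1(2) fin(1) posA _ type_II]; simp)+
  have "{\<omega> \<in> space P1. d \<omega> = 0} \<subseteq> ?E1"
  proof
    fix \<omega> assume \<omega>: "\<omega> \<in> {\<omega> \<in> space P1. d \<omega> = 0}"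
    then have "?acc (\<tau> \<omega>) \<omega>"
      using at_\<tau>[of \<omega>] by (auto simp: d_def split: if_splits)
    with \<omega> show "\<omega> \<in> ?E1"
      by blast
  qed
  then have II: "measure P1 {\<omega> \<in> space P1. d \<omega> = 0} \<le> \<beta>"
    using P1.finite_measure_mono[OF _ E1_meas] E1 budget(2) by (meson order_trans)
  show ?thesis
    using is_test I II by (simp add: test_eq tests_with_errors_def)
qed

lemma first_test_errors:
  fixes \<alpha> \<beta> :: real
  assumes params: "first_params n0 n1 N0 N \<kappa>0 \<kappa>1 K0" and nonneg: "0 \<le> \<alpha>" "0 \<le> \<beta>"
    and ok: "fixed_sample_ok P0 P1 T \<gamma> (\<beta> / 3) n0 \<kappa>0" "fixed_sample_ok P0 P1 T (\<alpha> / 2) \<delta> n1 \<kappa>1"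
      "fixed_sample_ok P0 P1 T \<gamma>' (\<beta> / 3) N0 K0" "fixed_sample_ok P0 P1 T (\<alpha> / 2) (\<beta> / 3) N K"
  shows "first_test T n0 n1 N0 N \<kappa>0 \<kappa>1 K0 K \<in> tests_with_errors M S X P0 P1 \<alpha> \<beta>"
proof -
  let ?A = "{(n0, \<kappa>0), (N0, K0), (N, K)}" and ?R = "{(n1, \<kappa>1), (N, K)}"
  have test_eq: "first_test T n0 n1 N0 N \<kappa>0 \<kappa>1 K0 K =
      stop_at_first_decision (\<lambda>n \<omega>. \<exists>k. (n, k) \<in> ?A \<and> T n \<omega> \<le> k)
        (\<lambda>n \<omega>. \<exists>k. (n, k) \<in> ?R \<and> T n \<omega> > k)"
    unfolding first_test_def by (intro arg_cong2[where f = stop_at_first_decision] ext) auto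
  show ?thesis
    unfolding test_eq
  proof (rule threshold_test_errors[where N = N and K = K and a = "\<alpha> / 2" and b = "\<beta> / 3"])
    show "real (card ?R) * (\<alpha> / 2) \<le> \<alpha>" "real (card ?A) * (\<beta> / 3) \<le> \<beta>"
      using nonneg by (auto simp: card_insert_if)
    show "1 \<le> n" if "(n, k) \<in> ?A \<union> ?R" for n k
      using that params unfolding first_params_def by (elim UnE insertE) auto
    show "measure P0 {\<omega> \<in> space P0. T n \<omega> > k} \<le> \<alpha> / 2" if "(n, k) \<in> ?R" for n k
      using that ok unfolding fixed_sample_ok_def by (elim insertE) simp_all
    show "measure P1 {\<omega> \<in> space P1. T n \<omega> \<le> k} \<le> \<beta> / 3" if "(n, k) \<in> ?A" for n k
      using that ok unfolding fixed_sample_ok_def by (elim insertE) simp_all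
  qed simp_all
qed

lemma second_test_errors:
  fixes \<alpha> \<beta> :: real
  assumes params: "second_params n0 n1 N1 N \<kappa>0 \<kappa>1 K1" and nonneg: "0 \<le> \<alpha>" "0 \<le> \<beta>"
    and ok: "fixed_sample_ok P0 P1 T \<gamma> (\<beta> / 2) n0 \<kappa>0" "fixed_sample_ok P0 P1 T (\<alpha> / 3) \<delta> n1 \<kappa>1"
      "fixed_sample_ok P0 P1 T (\<alpha> / 3) \<delta>' N1 K1" "fixed_sample_ok P0 P1 T (\<alpha> / 3) (\<beta> / 2) N K"
  shows "second_test T n0 n1 N1 N \<kappa>0 \<kappa>1 K1 K \<in> tests_with_errors M S X P0 P1 \<alpha> \<beta>"
proof -
  let ?A = "{(n0, \<kappa>0), (N, K)}" and ?R = "{(n1, \<kappa>1), (N1, K1), (N, K)}"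
  have test_eq: "second_test T n0 n1 N1 N \<kappa>0 \<kappa>1 K1 K =
      stop_at_first_decision (\<lambda>n \<omega>. \<exists>k. (n, k) \<in> ?A \<and> T n \<omega> \<le> k)
        (\<lambda>n \<omega>. \<exists>k. (n, k) \<in> ?R \<and> T n \<omega> > k)"
    unfolding second_test_def by (intro arg_cong2[where f = stop_at_first_decision] ext) auto
  show ?thesis
    unfolding test_eq
  proof (rule threshold_test_errors[where N = N and K = K and a = "\<alpha> / 3" and b = "\<beta> / 2"])
    show "real (card ?R) * (\<alpha> / 3) \<le> \<alpha>" "real (card ?A) * (\<beta> / 2) \<le> \<beta>"
      using nonneg by (auto simp: card_insert_if)
    show "1 \<le> n" if "(n, k) \<in> ?A \<union> ?R" for n k
      using that params unfolding second_params_def by (elim UnE insertE) auto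
    show "measure P0 {\<omega> \<in> space P0. T n \<omega> > k} \<le> \<alpha> / 3" if "(n, k) \<in> ?R" for n k
      using that ok unfolding fixed_sample_ok_def by (elim insertE) simp_all
    show "measure P1 {\<omega> \<in> space P1. T n \<omega> \<le> k} \<le> \<beta> / 2" if "(n, k) \<in> ?A" for n k
      using that ok unfolding fixed_sample_ok_def by (elim insertE) simp_all
  qed simp_all
qed

end

theorem theorem3p2:
  fixes M :: "'w measure" and S :: "'s measure" and X :: "nat \<Rightarrow> 'w \<Rightarrow> 's"
    and Laws Laws0 Laws1 :: "(nat \<Rightarrow> 's) measure set"
    and P0 P1 :: "'w measure" and T :: "nat \<Rightarrow> 'w \<Rightarrow> real"
    and \<kappa>_star :: "real \<Rightarrow> real \<Rightarrow> real" and \<alpha> \<beta> :: real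
  assumes "testing_problem M S X Laws Laws0 Laws1 P0 P1 T \<kappa>_star"
    and "0 < \<alpha>" "\<alpha> < 1" "0 < \<beta>" "\<beta> < 1"
  shows
    "(\<forall>\<gamma> \<gamma>' \<delta>. \<alpha> / 2 < \<gamma>' \<longrightarrow> \<gamma>' < \<gamma> \<longrightarrow> \<gamma> < 1 \<longrightarrow> \<beta> / 3 < \<delta> \<longrightarrow> \<delta> < 1 \<longrightarrow>
       (let n0 = n_star P0 P1 T \<gamma> (\<beta> / 3);       \<kappa>0 = \<kappa>_star \<gamma> (\<beta> / 3);
            n1 = n_star P0 P1 T (\<alpha> / 2) \<delta>;       \<kappa>1 = \<kappa>_star (\<alpha> / 2) \<delta>;
            N0 = n_star P0 P1 T \<gamma>' (\<beta> / 3);      K0 = \<kappa>_star \<gamma>' (\<beta> / 3);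
            N  = n_star P0 P1 T (\<alpha> / 2) (\<beta> / 3); K  = \<kappa>_star (\<alpha> / 2) (\<beta> / 3)
        in first_params n0 n1 N0 N \<kappa>0 \<kappa>1 K0 \<longrightarrow>
           first_test T n0 n1 N0 N \<kappa>0 \<kappa>1 K0 K \<in> tests_with_errors M S X P0 P1 \<alpha> \<beta>)) \<and>
     (\<forall>\<gamma> \<delta>' \<delta>. \<alpha> / 3 < \<gamma> \<longrightarrow> \<gamma> < 1 \<longrightarrow> \<beta> / 2 < \<delta>' \<longrightarrow> \<delta>' < \<delta> \<longrightarrow> \<delta> < 1 \<longrightarrow>
       (let n0 = n_star P0 P1 T \<gamma> (\<beta> / 2);       \<kappa>0 = \<kappa>_star \<gamma> (\<beta> / 2);
            n1 = n_star P0 P1 T (\<alpha> / 3) \<delta>;       \<kappa>1 = \<kappa>_star (\<alpha> / 3) \<delta>;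
            N1 = n_star P0 P1 T (\<alpha> / 3) \<delta>';      K1 = \<kappa>_star (\<alpha> / 3) \<delta>';
            N  = n_star P0 P1 T (\<alpha> / 3) (\<beta> / 2); K  = \<kappa>_star (\<alpha> / 3) (\<beta> / 2)
        in second_params n0 n1 N1 N \<kappa>0 \<kappa>1 K1 \<longrightarrow>
           second_test T n0 n1 N1 N \<kappa>0 \<kappa>1 K1 K \<in> tests_with_errors M S X P0 P1 \<alpha> \<beta>))"
proof -
  interpret testing_problem M S X Laws Laws0 Laws1 P0 P1 T \<kappa>_star
    by (rule assms(1))
  show ?thesis
    unfolding Let_def
  proof (intro conjI allI impI, goal_cases)
    case (1 \<gamma> \<gamma>' \<delta>)
    then show ?case
      using assms(2-5)
        by (intro first_test_errors[OF 1(6), where \<gamma> = \<gamma> and \<gamma>' = \<gamma>' and \<delta> = \<delta>]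
          \<kappa>_star) linarith+
  next
    case (2 \<gamma> \<delta>' \<delta>)
    then show ?case
      using assms(2-5)
        by (intro second_test_errors[OF 2(6), where \<gamma> = \<gamma> and \<delta>' = \<delta>' and \<delta> = \<delta>]
          \<kappa>_star) linarith+
  qed
qed

end
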